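(* Let $A_1,\dots,A_4$ be the vertices of a regular tetrahedron in Euclidean $3$-space with circumradius $R>0$. For every real constant $c>4R^4$, the locus of points $M$ in the space such that $$\sum_{i=1}^4 d_i^4=c,\qquad d_i=|MA_i|,$$ is a sphere whose center is the centroid of the tetrahedron.
   Context: $|MA_i|$ denotes Euclidean distance. A sphere means a sphere of positive radius. *)

theory Defs
  imports "HOL-Analysis.Analysis"
begin

text \<open>A family of four points in Euclidean 3-space is a function \<open>A\<close> on \<open>nat\<close> of which
  only the values \<open>A 1, \<dots>, A 4\<close> matter.\<close>

definition tetrahedron :: "(nat \<Rightarrow> real ^ 3) \<Rightarrow> bool" where
  "tetrahedron A \<longleftrightarrow> inj_on A {1..4} \<and> \<not> affine_dependent (A ` {1..4})"

definition regular_tetrahedron :: "(nat \<Rightarrow> real ^ 3) \<Rightarrow> bool" where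
  "regular_tetrahedron A \<longleftrightarrow> tetrahedron A \<and>
     (\<exists>a. \<forall>i\<in>{1..4}. \<forall>j\<in>{1..4}. i \<noteq> j \<longrightarrow> dist (A i) (A j) = a)"

text \<open>For a (nondegenerate) tetrahedron the sphere through its vertices exists and is unique,
  so this relation determines \<open>R\<close>.\<close>

definition has_circumradius :: "(nat \<Rightarrow> real ^ 3) \<Rightarrow> real \<Rightarrow> bool" where
  "has_circumradius A R \<longleftrightarrow> (\<exists>Q. A ` {1..4} \<subseteq> sphere Q R)"

definition centroid :: "(nat \<Rightarrow> real ^ 3) \<Rightarrow> real ^ 3" where
  "centroid A = (1 / 4) *\<^sub>R (\<Sum>i=1..4. A i)"

end

theory Submission
  imports Defs
begin

text \<open>Take the circumcenter as origin and let \<open>w\<^sub>i\<close> be the vertices. Regularity makes the Gram matrix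
  of the \<open>w\<^sub>i\<close> constant off the diagonal, so \<open>\<Sum> w\<^sub>i\<close> has the same inner product with every vertex
  and therefore vanishes: the centroid is the circumcenter. For the same reason every \<open>w\<^sub>i\<close> is
  an eigenvector, for one common eigenvalue \<open>4R\<^sup>2/3\<close>, of the frame operator
  \<open>x \<mapsto> \<Sum> (x \<bullet> w\<^sub>i) w\<^sub>i\<close>, whence \<open>\<Sum> (x \<bullet> w\<^sub>i)\<^sup>2 = 4R\<^sup>2|x|\<^sup>2/3\<close>. Expanding the fourth powers,
  the sum becomes an increasing quadratic polynomial in \<open>t = |x|\<^sup>2\<close> with value \<open>4R\<^sup>4\<close> at \<open>t = 0\<close>.\<close>

text \<open>A hyperplane is affine, so \<open>x \<mapsto> s \<bullet> x\<close> stays constant on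
  the whole affine hull; its values at \<open>s\<close> and at \<open>0\<close> then agree.\<close>

lemma orthogonal_affine_spanning_imp_zero:
  fixes s :: "'a::euclidean_space"
  assumes hull: "affine hull S = UNIV" and const: "\<And>x. x \<in> S \<Longrightarrow> s \<bullet> x = k"
  shows "s = 0"
proof -
  have "affine hull S \<subseteq> {x. s \<bullet> x = k}"
    using const by (intro hull_minimal affine_hyperplane) auto
  then have "s \<bullet> x = k" for x
    using hull by auto
  from this[of s] this[of 0] show ?thesis by simp
qed

text \<open>Models the vertices seen from the circumcenter: \<open>q\<close> is the squared
  circumradius, \<open>p\<close> the inner product of two distinct vertices, and \<open>hull\<close>
  expresses nondegeneracy.\<close>

locale equiangular_spanning_family =
  fixes I :: "'i set" and w :: "'i \<Rightarrow> 'a::euclidean_space" and p q :: real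
  assumes finite: "finite I"
    and hull: "affine hull (w ` I) = UNIV"
    and gram: "\<And>i j. i \<in> I \<Longrightarrow> j \<in> I \<Longrightarrow> w i \<bullet> w j = (if i = j then q else p)"
begin

lemma sum_gram:
  assumes "j \<in> I"
  shows "(\<Sum>i\<in>I. w i \<bullet> w j) = q + (real (card I) - 1) * p"
proof -
  have "(\<Sum>i\<in>I. w i \<bullet> w j) = (\<Sum>i\<in>I. p + (if i = j then q - p else 0))"
    using assms by (intro sum.cong) (auto simp: gram)
  then show ?thesis
    using assms finite by (simp add: sum.distrib algebra_simps)
qed

lemma sum_zero: "(\<Sum>i\<in>I. w i) = 0"
  by (rule orthogonal_affine_spanning_imp_zero[OF hull]) (auto simp: inner_sum_left sum_gram)

text \<open>Pairing the vanishing sum with a single vertex ties \<open>p\<close> to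
  \<open>q\<close>; a vertex exists because the affine hull is nonempty.\<close>

lemma gram_relation: "q + (real (card I) - 1) * p = 0"
proof -
  obtain j where "j \<in> I"
    using hull by fastforce
  then show ?thesis
    using sum_gram[of j] by (simp add: sum_zero flip: inner_sum_left)
qed

lemma frame_operator: "(\<Sum>i\<in>I. (x \<bullet> w i) *\<^sub>R w i) = (q - p) *\<^sub>R x"
proof (rule linear_eq_on[where f = "\<lambda>x. \<Sum>i\<in>I. (x \<bullet> w i) *\<^sub>R w i" and g = "\<lambda>x. (q - p) *\<^sub>R x"])
  show "linear (\<lambda>x. \<Sum>i\<in>I. (x \<bullet> w i) *\<^sub>R w i)"
    by (rule linearI) (simp_all add: inner_add_left scaleR_add_left sum.distrib scaleR_sum_right)
  show "linear (\<lambda>x::'a. (q - p) *\<^sub>R x)"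
    by (rule linearI) (simp_all add: scaleR_add_right)
  show "x \<in> span (w ` I)"
    using affine_hull_subset_span[of "w ` I"] hull by auto
  fix y assume "y \<in> w ` I"
  then obtain j where j: "j \<in> I" "y = w j" by blast
  \<comment> \<open>The Gram entries are \<open>p\<close> everywhere plus a correction
    \<open>q - p\<close> on the diagonal; the constant part multiplies the vanishing sum.\<close>
  have "(\<Sum>i\<in>I. (w j \<bullet> w i) *\<^sub>R w i) = (\<Sum>i\<in>I. p *\<^sub>R w i + (if j = i then (q - p) *\<^sub>R w i else 0))"
    using j(1) by (intro sum.cong) (auto simp: gram simp flip: scaleR_add_left)
  also have "\<dots> = p *\<^sub>R (\<Sum>i\<in>I. w i) + (q - p) *\<^sub>R w j"
    using j(1) finite by (simp add: sum.distrib scaleR_sum_right)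
  finally show "(\<Sum>i\<in>I. (y \<bullet> w i) *\<^sub>R w i) = (q - p) *\<^sub>R y"
    by (simp add: j(2) sum_zero)
qed

lemma sum_inner_squared: "(\<Sum>i\<in>I. (x \<bullet> w i)\<^sup>2) = (q - p) * (norm x)\<^sup>2"
proof -
  have "(\<Sum>i\<in>I. (x \<bullet> w i)\<^sup>2) = x \<bullet> (\<Sum>i\<in>I. (x \<bullet> w i) *\<^sub>R w i)"
    by (simp add: inner_sum_right power2_eq_square)
  then show ?thesis
    by (simp add: frame_operator power2_norm_eq_inner)
qed

text \<open>Squaring \<open>?m - 2 * (x \<bullet> w i)\<close> leaves a linear term, killed by
  \<open>sum_zero\<close>, and a quadratic one, evaluated by \<open>sum_inner_squared\<close>; only
  the norm of \<open>x\<close> survives.\<close>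

lemma sum_dist_power4:
  "(\<Sum>i\<in>I. dist x (w i) ^ 4) = real (card I) * ((norm x)\<^sup>2 + q)\<^sup>2 + 4 * (q - p) * (norm x)\<^sup>2"
proof -
  let ?m = "(norm x)\<^sup>2 + q"
  have "dist x (w i) ^ 4 = ?m\<^sup>2 - 4 * ?m * (x \<bullet> w i) + 4 * (x \<bullet> w i)\<^sup>2" if "i \<in> I" for i
  proof -
    have "(dist x (w i))\<^sup>2 = ?m - 2 * (x \<bullet> w i)"
      using gram[OF that that]
      by (simp add: dist_norm power2_norm_eq_inner inner_diff inner_commute)
    moreover have "dist x (w i) ^ 4 = ((dist x (w i))\<^sup>2)\<^sup>2"
      by simp
    ultimately show ?thesis
      by (simp only:) (simp add: power2_eq_square algebra_simps)
  qed
  then have "(\<Sum>i\<in>I. dist x (w i) ^ 4)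
      = real (card I) * ?m\<^sup>2 - 4 * ?m * (\<Sum>i\<in>I. x \<bullet> w i) + 4 * (\<Sum>i\<in>I. (x \<bullet> w i)\<^sup>2)"
    by (simp add: sum.distrib sum_subtractf sum_distrib_left)
  also have "(\<Sum>i\<in>I. x \<bullet> w i) = 0"
    by (simp add: sum_zero flip: inner_sum_right)
  finally show ?thesis
    by (simp add: sum_inner_squared)
qed

end

lemma regular_tetrahedron_equiangular:
  assumes "regular_tetrahedron A" and sphere: "A ` {1..4} \<subseteq> sphere Q R"
  obtains p where "equiangular_spanning_family {1..4} (\<lambda>i. A i - Q) p (R\<^sup>2)"
proof -
  have inj: "inj_on A {1..4}" and indep: "\<not> affine_dependent (A ` {1..4})"
    using assms(1) by (simp_all add: regular_tetrahedron_def tetrahedron_def)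
  from assms(1) obtain a where "\<forall>i\<in>{1..4}. \<forall>j\<in>{1..4}. i \<noteq> j \<longrightarrow> dist (A i) (A j) = a"
    unfolding regular_tetrahedron_def by (elim conjE exE)
  then have a: "dist (A i) (A j) = a" if "i \<in> {1..4}" "j \<in> {1..4}" "i \<noteq> j" for i j
    using that by simp
  \<comment> \<open>Four affinely independent points are one more than the dimension.\<close>
  have "affine hull (A ` {1..4}) = UNIV"
    using indep inj by (intro affine_independent_span_eq) (auto simp: card_image)
  moreover have "(\<lambda>i. A i - Q) ` {1..4} = (+) (- Q) ` A ` {1..4}"
    by (simp add: image_image)
  ultimately have hull: "affine hull ((\<lambda>i. A i - Q) ` {1..4}) = UNIV"
    by (simp only: affine_hull_translation) (simp add: surj_plus)
  have norm: "norm (A i - Q) = R" if "i \<in> {1..4}" for i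
    using subsetD[OF sphere imageI[OF that]] by (simp add: dist_norm norm_minus_commute)
  have "(A i - Q) \<bullet> (A j - Q) = (if i = j then R\<^sup>2 else R\<^sup>2 - a\<^sup>2 / 2)"
    if "i \<in> {1..4}" "j \<in> {1..4}" for i j
  proof (cases "i = j")
    case True
    then show ?thesis
      using norm[OF that(1)] by (simp flip: power2_norm_eq_inner)
  next
    case False
    \<comment> \<open>Polarization: equal norms and equal edges force equal inner products.\<close>
    have "a\<^sup>2 = (norm ((A i - Q) - (A j - Q)))\<^sup>2"
      using a[OF that False] by (simp add: dist_norm)
    also have "\<dots> = (norm (A i - Q))\<^sup>2 + (norm (A j - Q))\<^sup>2 - 2 * ((A i - Q) \<bullet> (A j - Q))"
      unfolding power2_norm_eq_inner by (simp add: inner_diff inner_commute)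
    finally show ?thesis
      unfolding norm[OF that(1)] norm[OF that(2)] using False by (simp add: field_simps)
  qed
  with hull show thesis
    by (intro that[of "R\<^sup>2 - a\<^sup>2 / 2"]) (unfold_locales, auto)
qed

text \<open>Completing the square: the coefficient of \<open>t\<close> is
  \<open>(8 + 16 / 3) * R\<^sup>2 = 4 * 2 * (5 / 3 * R\<^sup>2)\<close>.\<close>

lemma quadratic_eq_iff_unique_nonneg_root:
  fixes R c t :: real
  assumes "t \<ge> 0"
  shows "4 * (t + R\<^sup>2)\<^sup>2 + 16 / 3 * R\<^sup>2 * t = c
    \<longleftrightarrow> t = sqrt ((c - 4 * R ^ 4) / 4 + (5 / 3 * R\<^sup>2)\<^sup>2) - 5 / 3 * R\<^sup>2"
proof -
  let ?D = "(c - 4 * R ^ 4) / 4 + (5 / 3 * R\<^sup>2)\<^sup>2"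
  have "4 * (t + R\<^sup>2)\<^sup>2 + 16 / 3 * R\<^sup>2 * t = c \<longleftrightarrow> (t + 5 / 3 * R\<^sup>2)\<^sup>2 = ?D"
  proof -
    have "4 * (t + R\<^sup>2)\<^sup>2 + 16 / 3 * R\<^sup>2 * t - c = 4 * ((t + 5 / 3 * R\<^sup>2)\<^sup>2 - ?D)"
      by (simp add: power2_eq_square power4_eq_xxxx field_simps)
    then show ?thesis by (smt (verit))
  qed
  \<comment> \<open>Since \<open>t \<ge> 0\<close>, the base of the square is nonnegative, which
    excludes the other root.\<close>
  also have "\<dots> \<longleftrightarrow> sqrt ?D = t + 5 / 3 * R\<^sup>2"
    using assms real_sqrt_eq_iff[of ?D "(t + 5 / 3 * R\<^sup>2)\<^sup>2"] by auto
  finally show ?thesis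
    by auto
qed

theorem theorem6p1:
  fixes A :: "nat \<Rightarrow> real ^ 3" and R c :: real
  assumes "regular_tetrahedron A"
    and "has_circumradius A R"
    and "R > 0"
    and "c > 4 * R ^ 4"
  shows "\<exists>r>0. {M. (\<Sum>i=1..4. dist M (A i) ^ 4) = c} = sphere (centroid A) r"
proof -
  obtain Q where "A ` {1..4} \<subseteq> sphere Q R"
    using assms(2) unfolding has_circumradius_def by blast
  with assms(1) obtain p where "equiangular_spanning_family {1..4} (\<lambda>i. A i - Q) p (R\<^sup>2)"
    by (rule regular_tetrahedron_equiangular)
  then interpret equiangular_spanning_family "{1..4}" "\<lambda>i. A i - Q" p "R\<^sup>2" .
  have "(\<Sum>i=1..4. A i) = 4 *\<^sub>R Q"
    using sum_zero by (simp add: sum_subtractf scaleR_conv_of_real sum_constant_scaleR)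
  then have centroid: "centroid A = Q"
    by (simp add: centroid_def)
  \<comment> \<open>With four vertices, \<open>p\<close> equals
    \<open>- R\<^sup>2 / 3\<close>.\<close>
  have p: "4 * (R\<^sup>2 - p) = 16 / 3 * R\<^sup>2"
    using gram_relation by simp
  \<comment> \<open>The squared radius of the locus; it is positive because
    \<open>c > 4 * R ^ 4\<close> pushes the radicand above
    \<open>(5 / 3 * R\<^sup>2)\<^sup>2\<close>.\<close>
  define u where "u = sqrt ((c - 4 * R ^ 4) / 4 + (5 / 3 * R\<^sup>2)\<^sup>2) - 5 / 3 * R\<^sup>2"
  have "u > 0"
    using assms(4) unfolding u_def diff_gt_0_iff_gt by (intro real_less_rsqrt) simp
  have "(\<Sum>i=1..4. dist M (A i) ^ 4) = c \<longleftrightarrow> dist Q M = sqrt u" for M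
  proof -
    have "dist M (A i) = dist (M - Q) (A i - Q)" for i
      by (simp add: dist_norm)
    then have "(\<Sum>i=1..4. dist M (A i) ^ 4)
        = 4 * ((norm (M - Q))\<^sup>2 + R\<^sup>2)\<^sup>2 + 16 / 3 * R\<^sup>2 * (norm (M - Q))\<^sup>2"
      using sum_dist_power4[of "M - Q"] unfolding p by simp
    then have "(\<Sum>i=1..4. dist M (A i) ^ 4) = c \<longleftrightarrow> (norm (M - Q))\<^sup>2 = u"
      unfolding u_def by (simp only: quadratic_eq_iff_unique_nonneg_root zero_le_power2)
    also have "\<dots> \<longleftrightarrow> dist Q M = sqrt u"
      using \<open>u > 0\<close> by (auto simp: dist_norm norm_minus_commute)
    finally show ?thesis .
  qed
  then have "{M. (\<Sum>i=1..4. dist M (A i) ^ 4) = c} = sphere (centroid A) (sqrt u)"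
    unfolding centroid by (simp only: sphere_def)
  with \<open>u > 0\<close> show ?thesis
    by (metis real_sqrt_gt_zero)
qed

end
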